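(* Let $\mathcal C$ be a convex polygon in $\mathbb R^2$ and $O$ an interior point of it. Let $\varphi^*$ be a local maximizer for the function $\tilde f(\varphi)$, with $l(\varphi^* )\cap\mathcal C=[A^*B^*]$. Then at least one of the end-points $A^*$ and $B^*$ is a vertex of $\mathcal C$.
   Context: $l(\varphi)$ denotes the line through $O$ obtained by rotating a fixed line through $O$ by the angle $\varphi$ around $O$. $\tilde f(\varphi)$ is the length of the segment $l(\varphi)\cap\mathcal C$. *)

theory Defs
  imports "HOL-Analysis.Analysis"
begin

(* Counterclockwise rotation of the plane about the origin. *)
definition rot :: "real \<Rightarrow> real^2^2" where
  "rot \<phi> = vector [vector [cos \<phi>, - sin \<phi>], vector [sin \<phi>, cos \<phi>]]"

definition rotate_about :: "real^2 \<Rightarrow> real \<Rightarrow> real^2 \<Rightarrow> real^2" where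
  "rotate_about p \<phi> x = p + rot \<phi> *v (x - p)"

(* L is the fixed reference line through p, corresponding to the angle 0. *)
definition rotated_line :: "(real^2) set \<Rightarrow> real^2 \<Rightarrow> real \<Rightarrow> (real^2) set" where
  "rotated_line L p \<phi> = rotate_about p \<phi> ` L"

(* Unspecified unless S is a closed segment; well defined on segments by
   segment_length_closed_segment below. *)
definition segment_length :: "(real^2) set \<Rightarrow> real" where
  "segment_length S = (THE d. \<exists>a b. S = closed_segment a b \<and> d = dist a b)"

definition chord_length :: "(real^2) set \<Rightarrow> (real^2) set \<Rightarrow> real^2 \<Rightarrow> real \<Rightarrow> real" where
  "chord_length C L p \<phi> = segment_length (rotated_line L p \<phi> \<inter> C)"

definition local_maximizer :: "(real \<Rightarrow> real) \<Rightarrow> real \<Rightarrow> bool" where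
  "local_maximizer f x \<longleftrightarrow> (\<forall>\<^sub>F y in nhds x. f y \<le> f x)"

lemma segment_length_closed_segment: "segment_length (closed_segment a b) = dist a b"
proof -
  have uniq: "dist c d = dist a b" if eq: "closed_segment a b = closed_segment c d" for c d :: "real^2"
  proof -
    have "{x. x extreme_point_of closed_segment a b} = {x. x extreme_point_of closed_segment c d}"
      by (simp only: eq)
    then have "{a, b} = {c, d}"
      by (simp only: extreme_point_of_segment) blast
    then have "a = c \<and> b = d \<or> a = d \<and> b = c"
      by (simp only: doubleton_eq_iff)
    then show ?thesis
      by (elim disjE conjE) (simp_all only: dist_commute)
  qed
  show ?thesis
    unfolding segment_length_def
  proof (rule the_equality)
    show "\<exists>a' b'. closed_segment a b = closed_segment a' b' \<and> dist a b = dist a' b'"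
      by blast
  next
    fix e assume "\<exists>a' b'. closed_segment a b = closed_segment a' b' \<and> e = dist a' b'"
    then obtain a' b' where *: "closed_segment a b = closed_segment a' b'" "e = dist a' b'"
      by (elim exE conjE)
    show "e = dist a b"
      unfolding *(2) by (rule uniq[OF *(1)])
  qed
qed

lemma rotate_about_0: "rotate_about p 0 x = x"
  by (simp add: rotate_about_def rot_def vec_eq_iff matrix_vector_mult_def sum_2 forall_2)

lemma rotation_matrix_rot: "rotation_matrix (rot \<phi>)"
  by (simp add: rotation_matrix_def orthogonal_matrix rot_def det_2 vec_eq_iff
      matrix_matrix_mult_def transpose_def mat_def sum_2 forall_2 flip: power2_eq_square)

end

theory Submission
  imports Defs
begin

text \<open>
  Suppose neither end-point is a vertex. Then \<open>A\<close> and \<open>B\<close> lie in the relative interior of segments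
  contained in \<open>C\<close> and transversal to the line. In polar coordinates around \<open>p\<close>, at angle \<open>\<epsilon>\<close> from
  the given line, such a segment has the equation \<open>r(\<epsilon>) = a / (cos \<epsilon> - k sin \<epsilon>)\<close>, and
  \<open>r(\<epsilon>) + r(- \<epsilon>) > 2 r(0)\<close> for small \<open>\<epsilon> \<noteq> 0\<close>. Since \<open>C\<close> contains both segments, one of the two
  chords at the angles \<open>\<plusminus>\<epsilon>\<close> is longer than the given one.
\<close>

text \<open>With \<open>c = cos \<epsilon>\<close> and \<open>s = k * sin \<epsilon>\<close> the sum
  is \<open>2 * c / (c\<^sup>2 - s\<^sup>2)\<close>, and
  \<open>c\<^sup>2 - s\<^sup>2 \<le> c\<^sup>2 < c\<close> once \<open>0 < c < 1\<close>. The filter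
  is the punctured \<open>at 0\<close> because equality holds at
  \<open>\<epsilon> = 0\<close>.\<close>

lemma polar_line_midpoint_gt:
  fixes k :: real
  shows "\<forall>\<^sub>F \<epsilon> in at 0. 1 / (cos \<epsilon> - k * sin \<epsilon>) + 1 / (cos (- \<epsilon>) - k * sin (- \<epsilon>)) > 2"
proof -
  have pos: "\<forall>\<^sub>F \<epsilon> in at 0. 0 < cos \<epsilon> - m * sin \<epsilon>" for m :: real
  proof (rule order_tendstoD(1))
    show "((\<lambda>\<epsilon>. cos \<epsilon> - m * sin \<epsilon>) \<longlongrightarrow> cos 0 - m * sin 0) (at 0)"
      by (intro tendsto_intros)
  qed simp
  have small: "\<forall>\<^sub>F \<epsilon> in at (0::real). \<epsilon> \<noteq> 0 \<and> \<bar>\<epsilon>\<bar> < 1"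
    unfolding eventually_at by (rule exI[of _ 1]) auto
  show ?thesis
    using pos[of k] pos[of "- k"] small
  proof eventually_elim
    case (elim \<epsilon>)
    define c s where "c = cos \<epsilon>" and "s = k * sin \<epsilon>"
    have "sin \<epsilon> \<noteq> 0"
      using elim pi_gt3 sin_eq_0_pi[of \<epsilon>] by (auto simp: abs_less_iff)
    then have "c\<^sup>2 < 1"
      using sin_cos_squared_add[of \<epsilon>] unfolding c_def by (smt (verit) zero_less_power2)
    then have c: "0 < c" "c < 1"
      using elim by (auto simp: c_def abs_square_less_1 abs_less_iff)
    have cs: "0 < c - s" "0 < c + s"
      using elim by (auto simp: c_def s_def)
    have "(c - s) * (c + s) \<le> c * c"
      by (simp add: algebra_simps)
    also have "\<dots> < c"
      using c by simp
    finally have "2 < 2 * c / ((c - s) * (c + s))"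
      using cs by (simp add: less_divide_eq)
    also have "\<dots> = 1 / (c - s) + 1 / (c + s)"
      using cs by (simp add: field_simps)
    finally show ?case
      by (simp add: c_def s_def)
  qed
qed

text \<open>The counterclockwise quarter turn, matching the orientation of
  \<open>rot\<close>.\<close>

definition perp :: "real^2 \<Rightarrow> real^2" where
  "perp u = vector [- u $ 2, u $ 1]"

lemma perp_decomposition:
  assumes "norm u = 1"
  shows "z = (z \<bullet> u) *\<^sub>R u + (z \<bullet> perp u) *\<^sub>R perp u"
proof -
  have "u $ 1 * u $ 1 + u $ 2 * u $ 2 = 1"
    using assms by (simp add: norm_eq_1 inner_vec_def sum_2)
  then have u: "u $ 1 * u $ 1 = 1 - u $ 2 * u $ 2"
    by simp
  \<comment> \<open>The same relation as \<open>u\<close> in the right-nested form that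
    \<open>algebra_simps\<close> produces.\<close>
  have u': "u $ 1 * (u $ 1 * x) = x - u $ 2 * (u $ 2 * x)" for x
    using u by (metis mult.assoc left_diff_distrib mult_1)
  show ?thesis
    by (simp add: perp_def vec_eq_iff forall_2 inner_vec_def sum_2 algebra_simps u u')
qed

text \<open>In the frame of \<open>rot \<phi> *v d\<close> and its quarter turn, the directions near
  angle \<open>\<phi>\<close> look like those near angle 0.\<close>

lemma rot_add:
  "rot (\<phi> + \<epsilon>) *v d = cos \<epsilon> *\<^sub>R (rot \<phi> *v d) + sin \<epsilon> *\<^sub>R perp (rot \<phi> *v d)"
  by (simp add: rot_def perp_def vec_eq_iff forall_2 matrix_vector_mult_def sum_2
      cos_add sin_add algebra_simps)

lemma norm_rot: "norm (rot \<phi> *v d) = norm d"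
  using rotation_matrix_rot[of \<phi>] orthogonal_transformation_norm[of "(*v) (rot \<phi>)" d]
  by (simp add: rotation_matrix_def orthogonal_transformation_matrix)

lemma rotated_line_eq:
  assumes "L = range (\<lambda>c. p + c *\<^sub>R d)"
  shows "rotated_line L p \<phi> = range (\<lambda>c. p + c *\<^sub>R (rot \<phi> *v d))"
  by (simp add: assms rotated_line_def rotate_about_def image_image matrix_vector_mult_scaleR)

text \<open>The direction is normalised so that the parameter is the signed distance from
  \<open>p\<close>.\<close>

lemma affine_line_unit_direction:
  fixes p :: "'a::euclidean_space"
  assumes "affine L" "aff_dim L = 1" "p \<in> L"
  obtains d where "norm d = 1" "L = range (\<lambda>c. p + c *\<^sub>R d)"
proof -
  obtain q where q: "q \<in> L" "q \<noteq> p"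
    using assms(2,3) by (metis aff_dim_sing subsetI subset_singletonD insert_iff empty_iff zero_neq_one)
  have "aff_dim {p, q} = 1"
    using q by (simp add: aff_dim_2)
  then have "affine hull {p, q} = L"
    using assms q by (intro affine_dim_equal) (auto simp: hull_minimal)
  then have L: "L = range (\<lambda>c. p + c *\<^sub>R (q - p))"
    by (simp add: affine_hull_2_alt)
  define d where "d = (q - p) /\<^sub>R norm (q - p)"
  have "range (\<lambda>c. p + c *\<^sub>R (q - p)) = range (\<lambda>c. p + c *\<^sub>R d)"
  proof safe
    fix c
    show "p + c *\<^sub>R (q - p) \<in> range (\<lambda>c. p + c *\<^sub>R d)"
      using q by (intro range_eqI[of _ _ "c * norm (q - p)"]) (simp add: d_def)
    show "p + c *\<^sub>R d \<in> range (\<lambda>c. p + c *\<^sub>R (q - p))"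
      by (intro range_eqI[of _ _ "c / norm (q - p)"]) (simp add: d_def divide_inverse)
  qed
  with L q show ?thesis
    by (intro that[of d]) (simp_all add: d_def)
qed

text \<open>The intersection is compact, convex and collinear, and \<open>X\<close> makes it
  nonempty, so it is a segment and \<open>chord_length\<close> is its true length. Chords can thus
  be bounded from below without finding their end-points.\<close>

lemma dist_le_chord_length:
  assumes C: "compact C" "convex C" and L: "L = range (\<lambda>c. p + c *\<^sub>R d)"
    and X: "X \<in> rotated_line L p \<phi> \<inter> C" and Y: "Y \<in> rotated_line L p \<phi> \<inter> C"
  shows "dist X Y \<le> chord_length C L p \<phi>"
proof -
  let ?l = "rotated_line L p \<phi>"
  have l: "?l = range (\<lambda>c. p + c *\<^sub>R (rot \<phi> *v d))"
    by (rule rotated_line_eq[OF L])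
  have "?l = affine hull {p, p + rot \<phi> *v d}"
    unfolding l affine_hull_2_alt by simp
  then have "closed ?l" "convex ?l" "collinear ?l"
    by (simp_all add: collinear_affine_hull_collinear closed_affine_hull convex_affine_hull)
  then have "compact (?l \<inter> C)" "convex (?l \<inter> C)" "collinear (?l \<inter> C)"
    using C by (auto intro: closed_Int_compact convex_Int collinear_subset)
  then obtain a b where ab: "?l \<inter> C = closed_segment a b"
    using compact_convex_collinear_segment X by (metis empty_iff)
  then have "dist X Y \<le> dist a b"
    using X Y segment_furthest_le[of Y a b X] dist_in_closed_segment[of X a b]
    unfolding dist_norm by fastforce
  then show ?thesis
    by (simp add: chord_length_def ab segment_length_closed_segment)
qed

text \<open>A non-extreme point lies inside some segment of \<open>C\<close>. By \<open>ext\<close>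
  this segment is transversal to the line, so lines through \<open>p\<close> at small angles still
  meet it. The coordinate \<open>a\<close> is signed, so both ends of a chord are covered.\<close>

lemma eventually_polar_segment_in:
  fixes C :: "(real^2) set" and p u :: "real^2"
  assumes C: "convex C" and u: "norm u = 1"
    and A: "p + a *\<^sub>R u \<in> C" "\<not> (p + a *\<^sub>R u) extreme_point_of C"
    and ext: "(p + a *\<^sub>R u) extreme_point_of (range (\<lambda>c. p + c *\<^sub>R u) \<inter> C)"
  obtains k where
    "\<forall>\<^sub>F \<epsilon> in nhds 0. p + (a / (cos \<epsilon> - k * sin \<epsilon>)) *\<^sub>R (cos \<epsilon> *\<^sub>R u + sin \<epsilon> *\<^sub>R perp u) \<in> C"
proof -
  let ?A = "p + a *\<^sub>R u" and ?n = "perp u"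
  obtain x y where xy: "x \<in> C" "y \<in> C" "?A \<in> open_segment x y"
    using A by (auto simp: extreme_point_of_def)
  then obtain t where t: "0 < t" "t < 1" "?A = (1 - t) *\<^sub>R x + t *\<^sub>R y"
    by (auto simp: in_segment)
  define x1 x2 y1 y2 where xy_defs: "x1 = (x - ?A) \<bullet> u" "x2 = (x - ?A) \<bullet> ?n"
    "y1 = (y - ?A) \<bullet> u" "y2 = (y - ?A) \<bullet> ?n"
  have x: "x = ?A + x1 *\<^sub>R u + x2 *\<^sub>R ?n"
    using perp_decomposition[OF u, of "x - ?A"] by (simp add: xy_defs algebra_simps)
  have y: "y = ?A + y1 *\<^sub>R u + y2 *\<^sub>R ?n"
    using perp_decomposition[OF u, of "y - ?A"] by (simp add: xy_defs algebra_simps)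
  have 0: "(1 - t) *\<^sub>R (x - ?A) + t *\<^sub>R (y - ?A) = 0"
    using t(3) by (simp add: algebra_simps)
  have rel: "(1 - t) * x1 + t * y1 = 0" "(1 - t) * x2 + t * y2 = 0"
    using arg_cong[OF 0, of "\<lambda>z. z \<bullet> u"] arg_cong[OF 0, of "\<lambda>z. z \<bullet> ?n"]
    unfolding xy_defs by (simp_all only: inner_add_left inner_scaleR_left inner_zero_left)
  \<comment> \<open>As \<open>?A\<close> lies between \<open>x\<close> and \<open>y\<close>, the
    vector \<open>y - ?A\<close> is \<open>- q\<close> times \<open>x - ?A\<close>.\<close>
  define q where "q = (1 - t) / t"
  have q: "q > 0" using t by (simp add: q_def)
  have yq: "y1 = - q * x1" "y2 = - q * x2"
    using rel t by (auto simp: q_def field_simps)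
  \<comment> \<open>Otherwise \<open>x\<close> and \<open>y\<close> lie on the line itself, and
    \<open>?A\<close> is interior to a segment of the chord, against \<open>ext\<close>.\<close>
  have "x2 \<noteq> 0"
  proof
    assume "x2 = 0"
    then have "x = p + (a + x1) *\<^sub>R u" "y = p + (a + y1) *\<^sub>R u"
      using x y yq by (simp_all add: algebra_simps)
    then have "x \<in> range (\<lambda>c. p + c *\<^sub>R u) \<inter> C" "y \<in> range (\<lambda>c. p + c *\<^sub>R u) \<inter> C"
      using xy by blast+
    then show False
      using ext xy(3) by (auto simp: extreme_point_of_def)
  qed
  \<comment> \<open>The inverse slope of the segment in the frame \<open>u\<close>,
    \<open>?n\<close>; the parameter of \<open>?g\<close> is the \<open>?n\<close>-coordinate
    relative to \<open>?A\<close>.\<close>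
  define k where "k = x1 / x2"
  let ?g = "\<lambda>\<tau>. ?A + \<tau> *\<^sub>R (k *\<^sub>R u + ?n)"
  have gx: "?g x2 = x" and gy: "?g y2 = y"
    using \<open>x2 \<noteq> 0\<close> x y yq by (simp_all add: k_def algebra_simps)
  have g_in: "?g \<tau> \<in> C" if \<tau>: "\<tau> \<in> open_segment x2 y2" for \<tau>
  proof -
    obtain s where s: "0 \<le> s" "s \<le> 1" "\<tau> = (1 - s) *\<^sub>R x2 + s *\<^sub>R y2"
      using \<tau> unfolding in_segment by (metis less_imp_le)
    have "?g \<tau> = (1 - s) *\<^sub>R ?g x2 + s *\<^sub>R ?g y2"
      unfolding s(3) by (simp add: algebra_simps)
    then show ?thesis
      using C xy s unfolding gx gy by (simp add: convex_alt)
  qed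
  have zero_in: "0 \<in> open_segment x2 y2"
    using \<open>x2 \<noteq> 0\<close> q yq t unfolding in_segment
    by (intro conjI exI[of _ t]) (use rel(2) in \<open>auto simp: field_simps q_def\<close>)
  have D: "((\<lambda>\<epsilon>. cos \<epsilon> - k * sin \<epsilon>) \<longlongrightarrow> cos 0 - k * sin 0) (nhds 0)"
    by (intro tendsto_intros filterlim_ident)
  \<comment> \<open>This is the value of the parameter of \<open>?g\<close> where the line at angle
    \<open>\<epsilon>\<close> meets the segment. It tends to 0, which is interior to the parameter
    interval.\<close>
  have "((\<lambda>\<epsilon>. a * sin \<epsilon> / (cos \<epsilon> - k * sin \<epsilon>)) \<longlongrightarrow> a * sin 0 / (cos 0 - k * sin 0)) (nhds 0)"
    by (intro tendsto_intros filterlim_ident) auto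
  then have "\<forall>\<^sub>F \<epsilon> in nhds 0. a * sin \<epsilon> / (cos \<epsilon> - k * sin \<epsilon>) \<in> open_segment x2 y2"
    by (rule topological_tendstoD) (use zero_in in \<open>auto simp: open_segment_eq_real_ivl\<close>)
  moreover have "\<forall>\<^sub>F \<epsilon> in nhds 0. 0 < cos \<epsilon> - k * sin \<epsilon>"
    using D by (rule order_tendstoD(1)) simp
  ultimately have "\<forall>\<^sub>F \<epsilon> in nhds 0.
      p + (a / (cos \<epsilon> - k * sin \<epsilon>)) *\<^sub>R (cos \<epsilon> *\<^sub>R u + sin \<epsilon> *\<^sub>R ?n) \<in> C"
  proof eventually_elim
    case (elim \<epsilon>)
    define D where "D = cos \<epsilon> - k * sin \<epsilon>"
    have "D \<noteq> 0" and co: "cos \<epsilon> = D + k * sin \<epsilon>"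
      using elim by (simp_all add: D_def)
    then have "p + (a / D) *\<^sub>R (cos \<epsilon> *\<^sub>R u + sin \<epsilon> *\<^sub>R ?n) = ?g (a * sin \<epsilon> / D)"
      unfolding co by (simp add: algebra_simps add_divide_distrib)
    then show ?case
      using g_in[OF elim(1)] by (simp only: D_def)
  qed
  then show ?thesis by (rule that)
qed

text \<open>Since \<open>p\<close> is strictly between the ends, both distances \<open>a\<close> and
  \<open>- b\<close> grow on average over the angles \<open>\<plusminus>\<epsilon>\<close>, each end
  with its own inverse slope. The two chord lengths therefore have a sum above
  \<open>2 * (a - b)\<close>.\<close>

lemma not_local_maximizer_chord_length:
  fixes C :: "(real^2) set" and p d :: "real^2"
  defines "u \<equiv> \<lambda>\<phi>. rot \<phi> *v d"
  assumes C: "compact C" "convex C" and d: "norm d = 1" and L: "L = range (\<lambda>c. p + c *\<^sub>R d)"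
    and seg: "rotated_line L p \<phi> \<inter> C = closed_segment (p + a *\<^sub>R u \<phi>) (p + b *\<^sub>R u \<phi>)"
    and ab: "b < 0" "0 < a"
    and ext: "\<not> (p + a *\<^sub>R u \<phi>) extreme_point_of C" "\<not> (p + b *\<^sub>R u \<phi>) extreme_point_of C"
  shows "\<not> local_maximizer (chord_length C L p) \<phi>"
proof
  assume max: "local_maximizer (chord_length C L p) \<phi>"
  have nu: "norm (u \<theta>) = 1" for \<theta>
    by (simp add: u_def norm_rot d)
  have line: "rotated_line L p \<theta> = range (\<lambda>c. p + c *\<^sub>R u \<theta>)" for \<theta>
    unfolding u_def by (rule rotated_line_eq[OF L])
  note seg' = seg[unfolded line]
  have in_C: "p + a *\<^sub>R u \<phi> \<in> C" "p + b *\<^sub>R u \<phi> \<in> C"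
    using seg' by (metis IntD2 ends_in_segment)+
  have e: "(p + a *\<^sub>R u \<phi>) extreme_point_of (range (\<lambda>c. p + c *\<^sub>R u \<phi>) \<inter> C)"
    "(p + b *\<^sub>R u \<phi>) extreme_point_of (range (\<lambda>c. p + c *\<^sub>R u \<phi>) \<inter> C)"
    unfolding seg' by (simp_all add: extreme_point_of_segment)
  define r where "r = (\<lambda>k (c::real) \<epsilon>. c / (cos \<epsilon> - k * sin \<epsilon>))"
  have u_add: "u (\<phi> + \<epsilon>) = cos \<epsilon> *\<^sub>R u \<phi> + sin \<epsilon> *\<^sub>R perp (u \<phi>)" for \<epsilon>
    unfolding u_def by (rule rot_add)
  obtain k where k: "\<forall>\<^sub>F \<epsilon> in nhds 0. p + r k a \<epsilon> *\<^sub>R u (\<phi> + \<epsilon>) \<in> C"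
    using eventually_polar_segment_in[OF C(2) nu in_C(1) ext(1) e(1)] unfolding u_add r_def by blast
  obtain m where m: "\<forall>\<^sub>F \<epsilon> in nhds 0. p + r m b \<epsilon> *\<^sub>R u (\<phi> + \<epsilon>) \<in> C"
    using eventually_polar_segment_in[OF C(2) nu in_C(2) ext(2) e(2)] unfolding u_add r_def by blast
  have f0: "chord_length C L p \<phi> = a - b"
    using ab nu[of \<phi>] unfolding chord_length_def seg segment_length_closed_segment dist_norm
    by (simp flip: scaleR_diff_left)
  have "((\<lambda>\<epsilon>. \<phi> + \<epsilon>) \<longlongrightarrow> \<phi> + 0) (nhds 0)"
    by (intro tendsto_intros filterlim_ident)
  then have "\<forall>\<^sub>F \<epsilon> in nhds 0. chord_length C L p (\<phi> + \<epsilon>) \<le> a - b"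
    using max unfolding local_maximizer_def f0 by (auto dest: eventually_compose_filterlim)
  with k m have near: "\<forall>\<^sub>F \<epsilon> in nhds 0. r k a \<epsilon> - r m b \<epsilon> \<le> a - b"
  proof eventually_elim
    case (elim \<epsilon>)
    have "r k a \<epsilon> - r m b \<epsilon> \<le> dist (p + r k a \<epsilon> *\<^sub>R u (\<phi> + \<epsilon>)) (p + r m b \<epsilon> *\<^sub>R u (\<phi> + \<epsilon>))"
      using nu[of "\<phi> + \<epsilon>"] by (simp add: dist_norm flip: scaleR_diff_left)
    also have "\<dots> \<le> chord_length C L p (\<phi> + \<epsilon>)"
      by (rule dist_le_chord_length[OF C L]) (use elim line in blast)+
    finally show ?case using elim by simp
  qed
  have "((\<lambda>\<epsilon>::real. - \<epsilon>) \<longlongrightarrow> - 0) (nhds 0)"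
    by (intro tendsto_intros filterlim_ident)
  then have "\<forall>\<^sub>F \<epsilon> in nhds 0. r k a (- \<epsilon>) - r m b (- \<epsilon>) \<le> a - b"
    using near by (auto dest: eventually_compose_filterlim)
  \<comment> \<open>Passing to the punctured filter excludes \<open>\<epsilon> = 0\<close>, where
    the strict inequality fails.\<close>
  with near have "\<forall>\<^sub>F \<epsilon> in at 0. r k a \<epsilon> - r m b \<epsilon> \<le> a - b \<and> r k a (- \<epsilon>) - r m b (- \<epsilon>) \<le> a - b"
    by (auto simp: eventually_at_filter elim: eventually_elim2)
  with polar_line_midpoint_gt[of k] polar_line_midpoint_gt[of m]
  have "\<forall>\<^sub>F \<epsilon> in at (0::real). False"
  proof eventually_elim
    case (elim \<epsilon>)
    \<comment> \<open>Homogeneity reduces both ends to numerator 1; the negative factor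
      \<open>b\<close> then reverses the inequality.\<close>
    have r: "r j c \<theta> = c * r j 1 \<theta>" for j c \<theta>
      by (simp add: r_def)
    have "a * 2 < a * (r k 1 \<epsilon> + r k 1 (- \<epsilon>))" "b * (r m 1 \<epsilon> + r m 1 (- \<epsilon>)) < b * 2"
      using elim(1,2) ab unfolding r_def
      by (intro mult_strict_left_mono mult_strict_left_mono_neg; simp)+
    then have "2 * (a - b) < (r k a \<epsilon> - r m b \<epsilon>) + (r k a (- \<epsilon>) - r m b (- \<epsilon>))"
      unfolding r[of k a] r[of m b] by (simp add: algebra_simps)
    moreover have "r k a \<epsilon> - r m b \<epsilon> \<le> a - b" "r k a (- \<epsilon>) - r m b (- \<epsilon>) \<le> a - b"
      using elim(3) by blast+
    ultimately show ?case by argo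
  qed
  then show False by simp
qed

theorem proposition7:
  fixes C L :: "(real^2) set" and p A B :: "real^2" and \<phi> :: real
  assumes "polytope C"
    and "p \<in> interior C"
    and "affine L" and "aff_dim L = 1" and "p \<in> L"
    and "local_maximizer (chord_length C L p) \<phi>"
    and "rotated_line L p \<phi> \<inter> C = closed_segment A B"
  shows "A extreme_point_of C \<or> B extreme_point_of C"
proof (rule ccontr)
  assume neg: "\<not> (A extreme_point_of C \<or> B extreme_point_of C)"
  have C: "compact C" "convex C"
    using assms(1) by (simp_all add: polytope_imp_compact polytope_imp_convex)
  obtain d where d: "norm d = 1" and L: "L = range (\<lambda>c. p + c *\<^sub>R d)"
    using affine_line_unit_direction assms(3-5) by blast
  define u where "u = rot \<phi> *v d"
  have nu: "norm u = 1"
    by (simp add: u_def norm_rot d)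
  have line: "rotated_line L p \<phi> = range (\<lambda>c. p + c *\<^sub>R u)"
    unfolding u_def by (rule rotated_line_eq[OF L])
  have "A \<in> rotated_line L p \<phi>" "B \<in> rotated_line L p \<phi>"
    using assms(7) by (metis IntD1 ends_in_segment)+
  then obtain a b where A: "A = p + a *\<^sub>R u" and B: "B = p + b *\<^sub>R u"
    unfolding line by blast
  obtain h where h: "h > 0" "cball p h \<subseteq> C"
    using assms(2) by (auto simp: mem_interior_cball)
  \<comment> \<open>A ball around \<open>p\<close> inside \<open>C\<close> puts both
    \<open>h\<close> and \<open>- h\<close> between \<open>a\<close> and \<open>b\<close>, which
    forces opposite signs.\<close>
  have coord: "c \<in> closed_segment a b" if "\<bar>c\<bar> \<le> h" for c
  proof -
    have "p + c *\<^sub>R u \<in> cball p h"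
      using that nu by (simp add: dist_norm)
    then have "p + c *\<^sub>R u \<in> closed_segment A B"
      using h line assms(7) by blast
    then obtain s where s: "0 \<le> s" "s \<le> 1" "p + c *\<^sub>R u = (1 - s) *\<^sub>R A + s *\<^sub>R B"
      by (auto simp: in_segment)
    have "(1 - s) *\<^sub>R A + s *\<^sub>R B = p + ((1 - s) * a + s * b) *\<^sub>R u"
      by (simp add: A B algebra_simps)
    then have "c = (1 - s) * a + s * b"
      using s(3) nu by auto
    with s show ?thesis by (auto simp: in_segment)
  qed
  have "b < 0 \<and> 0 < a \<or> a < 0 \<and> 0 < b"
    using coord[of h] coord[of "- h"] h(1) by (auto simp: closed_segment_eq_real_ivl split: if_splits)
  \<comment> \<open>The order of \<open>A\<close> and \<open>B\<close> on the line is unknown, so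
    the lemma is used in both orientations.\<close>
  then show False
    using not_local_maximizer_chord_length[OF C d L, of \<phi> a b]
      not_local_maximizer_chord_length[OF C d L, of \<phi> b a]
      assms(6,7) neg closed_segment_commute[of A B]
    unfolding u_def[symmetric] A[symmetric] B[symmetric] by auto
qed

end
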